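(* Let $D=(V,A)$ be a directed graph with $n=|V|$ and $m=|A|$, $s,t\in V$, $c:A\to\mathbb{R}_{\geq 0}$, and $k\geq 2$ an integer such that $D$ contains at least $k$ simple $s$-$t$-paths. The algorithm solving the $k$-Shortest Simple Path problem on $(D,s,t,c,k)$ via the Roditty–Zwick scheme with $\text{BDA}_{2\text{SSP}}$ subroutines uses $\mathcal{O}(kn+n^2+m)$ memory.
   Context: The $k$-Shortest Simple Path problem asks for a sequence $(p_1,\dots,p_k)$ of pairwise distinct simple $s$-$t$-paths with $c(p_i)\leq c(p_{i+1})$ for all $i$, such that no simple $s$-$t$-path outside the sequence has cost strictly less than $c(p_k)$; the cost of a path is the sum of its arc costs. The algorithm stores the found paths in a deviation tree (a rooted tree in which each found path is represented by appending to the tree its suffix after its longest common prefix with a previously found path), computes $p_1$ by a shortest path computation, and then in each of $k-1$ iterations extracts a cheapest candidate path from a priority queue and performs, one after another, at most two second-shortest-simple-path computations (on subgraphs obtained by deleting a prefix of a path and some blocked deviation arcs), each done with $\text{BDA}_{2\text{SSP}}$: the One-to-One Biobjective Dijkstra Algorithm run with the cost pair (original cost, indicator of lying on the current path), stopped as soon as an efficient path to $t$ using fewer arcs of the current path than the current path itself is extracted. *)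

theory Defs
  imports
    "Graph_Theory.Graph_Theory"
    "HOL-Library.Multiset"
begin

text \<open>
  Memory is measured on a unit-cost machine: a vertex, an arc, an integer (array index, pointer,
  counter) or a real number takes one word.  The algorithm is a transition system whose
  configurations consist of the data the algorithm stores.  Inside a search and in the deviation
  tree paths are represented by predecessor pointers; explicit arc lists (candidates, search
  results) are charged by their length.  Free choices (ties, the order in which incident arcs are
  visited) are nondeterministic.
\<close>

text \<open>
  Rooted trees are arrays of predecessor entries: a root has entry \<^term>\<open>None\<close>, any other node
  the index of its parent and the arc that leads to it.  Parents precede their children,
  so the test \<open>j < i\<close> below never fails on the trees that are built.
\<close>

type_synonym 'a entry = "(nat \<times> 'a) option"

fun trace :: "'a entry list \<Rightarrow> nat \<Rightarrow> 'a list" where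
  "trace T i = (case T ! i of None \<Rightarrow> []
     | Some (j, a) \<Rightarrow> if j < i then trace T j @ [a] else [])"

declare trace.simps [simp del]


subsection \<open>The One-to-One Biobjective Dijkstra Algorithm\<close>

text \<open>
  \<open>lab_hits\<close> is the second cost component, the number of arcs lying on the current path.
  \<open>lab_pred\<close> points to the permanent label that was extended.
\<close>

record ('v, 'a) label =
  lab_node :: 'v
  lab_cost :: real
  lab_hits :: nat
  lab_pred :: "'a entry"

definition lex_less :: "('v, 'a) label \<Rightarrow> ('v, 'a) label \<Rightarrow> bool" where
  "lex_less l l' \<longleftrightarrow> lab_cost l < lab_cost l' \<or> lab_cost l = lab_cost l' \<and> lab_hits l < lab_hits l'"

definition lex_better :: "('v, 'a) label option \<Rightarrow> ('v, 'a) label \<Rightarrow> ('v, 'a) label" where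
  "lex_better x l = (case x of None \<Rightarrow> l | Some l' \<Rightarrow> if lex_less l l' then l else l')"

text \<open>
  A search runs on a digraph \<open>graph\<close> from \<open>source\<close>; \<open>marked\<close> are the arcs of the current path and
  a label at the target stops the search if it has fewer than \<open>bound\<close> hits.
\<close>

record ('v, 'a) search_inst =
  graph :: "('v, 'a) pre_digraph"
  source :: 'v
  marked :: "'a set"
  bound :: nat

text \<open>
  \<open>Scan i A b\<close>: searching the next queue label for the vertex of permanent label \<open>i\<close>, with
  incoming arcs \<open>A\<close> still to be visited and best candidate \<open>b\<close> so far.
  \<open>Propagate i A\<close>: extending permanent label \<open>i\<close> along the remaining outgoing arcs \<open>A\<close>.
\<close>

datatype ('v, 'a) bda_control =
    Select
  | Scan nat "'a set" "('v, 'a) label option"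
  | Propagate nat "'a set"
  | Stopped "'a list option"

text \<open>
  \<open>labels\<close> are the permanent labels in order of extraction, \<open>perm v\<close> the indices of those at \<open>v\<close>,
  \<open>queue\<close> the priority queue with at most one label per vertex, and \<open>next_perm a\<close> the position in
  \<open>perm\<close> of the tail of \<open>a\<close> before which all extensions along \<open>a\<close> are known to be dominated.
\<close>

record ('v, 'a) bda_state =
  labels :: "('v, 'a) label list"
  perm :: "'v \<Rightarrow> nat list"
  queue :: "'v \<Rightarrow> ('v, 'a) label option"
  next_perm :: "'a \<Rightarrow> nat"
  control :: "('v, 'a) bda_control"

definition bda_init :: "('v, 'a) search_inst \<Rightarrow> ('v, 'a) bda_state" where
  "bda_init I =
     \<lparr>labels = [], perm = (\<lambda>_. []),
      queue = [source I \<mapsto> \<lparr>lab_node = source I, lab_cost = 0, lab_hits = 0, lab_pred = None\<rparr>],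
      next_perm = (\<lambda>_. 0), control = Select\<rparr>"

definition extend ::
  "('v, 'a) search_inst \<Rightarrow> ('a \<Rightarrow> real) \<Rightarrow> ('v, 'a) bda_state \<Rightarrow> nat \<Rightarrow> 'a \<Rightarrow> ('v, 'a) label" where
  "extend I c S i a =
     \<lparr>lab_node = head (graph I) a,
      lab_cost = lab_cost (labels S ! i) + c a,
      lab_hits = lab_hits (labels S ! i) + (if a \<in> marked I then 1 else 0),
      lab_pred = Some (i, a)\<rparr>"

text \<open>
  Labels become permanent in lexicographic order.  Hence a new label is weakly
  dominated by a permanent label at its vertex, or at the target, iff its second cost component
  is not smaller than that of the last permanent label there.
\<close>

definition dominated :: "'v \<Rightarrow> ('v, 'a) bda_state \<Rightarrow> ('v, 'a) label \<Rightarrow> bool" where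
  "dominated t S l \<longleftrightarrow>
     (\<exists>v\<in>{lab_node l, t}. perm S v \<noteq> [] \<and> lab_hits (labels S ! last (perm S v)) \<le> lab_hits l)"

definition lex_min_queue :: "('v, 'a) bda_state \<Rightarrow> 'v \<Rightarrow> ('v, 'a) label \<Rightarrow> bool" where
  "lex_min_queue S v l \<longleftrightarrow>
     queue S v = Some l \<and> (\<forall>w l'. queue S w = Some l' \<longrightarrow> \<not> lex_less l' l)"

definition label_path :: "('v, 'a) bda_state \<Rightarrow> ('v, 'a) label \<Rightarrow> 'a list" where
  "label_path S l = trace (map lab_pred (labels S @ [l])) (length (labels S))"

inductive bda_step ::
  "('v, 'a) search_inst \<Rightarrow> ('a \<Rightarrow> real) \<Rightarrow> 'v \<Rightarrow> ('v, 'a) bda_state \<Rightarrow> ('v, 'a) bda_state \<Rightarrow> bool"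
  for I :: "('v, 'a) search_inst" and c :: "'a \<Rightarrow> real" and t :: 'v
where
  accept:
    "\<lbrakk>control S = Select; lex_min_queue S t l; lab_hits l < bound I\<rbrakk>
     \<Longrightarrow> bda_step I c t S (S\<lparr>control := Stopped (Some (label_path S l))\<rparr>)"
| exhausted:
    "\<lbrakk>control S = Select; queue S = Map.empty\<rbrakk>
     \<Longrightarrow> bda_step I c t S (S\<lparr>control := Stopped None\<rparr>)"
| settle:
    "\<lbrakk>control S = Select; lex_min_queue S v l; \<not> (v = t \<and> lab_hits l < bound I)\<rbrakk>
     \<Longrightarrow> bda_step I c t S
          (S\<lparr>labels := labels S @ [l],
             perm := (perm S)(v := perm S v @ [length (labels S)]),
             queue := (queue S)(v := None),
             control := Scan (length (labels S)) (in_arcs (graph I) v) None\<rparr>)"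
| scan_none:
    "\<lbrakk>control S = Scan i A b; a \<in> A; length (perm S (tail (graph I) a)) \<le> next_perm S a\<rbrakk>
     \<Longrightarrow> bda_step I c t S (S\<lparr>control := Scan i (A - {a}) b\<rparr>)"
| scan_dominated:
    "\<lbrakk>control S = Scan i A b; a \<in> A; next_perm S a < length (perm S (tail (graph I) a));
      l = extend I c S (perm S (tail (graph I) a) ! next_perm S a) a; dominated t S l\<rbrakk>
     \<Longrightarrow> bda_step I c t S (S\<lparr>next_perm := (next_perm S)(a := Suc (next_perm S a))\<rparr>)"
| scan_candidate:
    "\<lbrakk>control S = Scan i A b; a \<in> A; next_perm S a < length (perm S (tail (graph I) a));
      l = extend I c S (perm S (tail (graph I) a) ! next_perm S a) a; \<not> dominated t S l\<rbrakk>
     \<Longrightarrow> bda_step I c t S (S\<lparr>control := Scan i (A - {a}) (Some (lex_better b l))\<rparr>)"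
| scan_done:
    "\<lbrakk>control S = Scan i {} b; v = lab_node (labels S ! i)\<rbrakk>
     \<Longrightarrow> bda_step I c t S
          (S\<lparr>queue := (queue S)(v := b), control := Propagate i (out_arcs (graph I) v)\<rparr>)"
| propagate_dominated:
    "\<lbrakk>control S = Propagate i A; a \<in> A; dominated t S (extend I c S i a)\<rbrakk>
     \<Longrightarrow> bda_step I c t S (S\<lparr>control := Propagate i (A - {a})\<rparr>)"
| propagate_queue:
    "\<lbrakk>control S = Propagate i A; a \<in> A; l = extend I c S i a; \<not> dominated t S l;
      w = head (graph I) a\<rbrakk>
     \<Longrightarrow> bda_step I c t S
          (S\<lparr>queue := (queue S)(w := Some (lex_better (queue S w) l)),
             control := Propagate i (A - {a})\<rparr>)"
| propagate_done:
    "control S = Propagate i {} \<Longrightarrow> bda_step I c t S (S\<lparr>control := Select\<rparr>)"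


subsection \<open>The Roditty--Zwick scheme\<close>

text \<open>
  \<open>leaf\<close> is the end of the path in the deviation tree, \<open>dev_len\<close> the number of arcs of the
  path up to and including its deviation arc (\<open>0\<close> for the first path), and \<open>blocked\<close> the arcs by
  which its children deviate from it.
\<close>

record 'a found_path =
  leaf :: nat
  dev_len :: nat
  blocked :: "'a list"

text \<open>
  A candidate deviates from found path number \<open>cand_parent\<close>; only its part after the first
  \<open>dev_len\<close> arcs of that parent is stored.
\<close>

record 'a candidate =
  cand_cost :: real
  cand_parent :: nat
  cand_suffix :: "'a list"

text \<open>
  \<open>Search j I S js\<close>: a search \<open>S\<close> for a shortest path (\<open>j = None\<close>) or for a second shortest
  simple path with respect to found path \<open>j\<close>, after which the found paths \<open>js\<close> are to be treated.
  \<open>Insert j q\<close>: the path \<open>q\<close> with parent \<open>j\<close> is about to enter the deviation tree.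
\<close>

datatype ('v, 'a) phase =
    Idle
  | Search "nat option" "('v, 'a) search_inst" "('v, 'a) bda_state" "nat list"
  | Insert "nat option" "'a list"

record ('v, 'a) config =
  tree :: "'a entry list"
  found :: "'a found_path list"
  cands :: "'a candidate multiset"
  phase :: "('v, 'a) phase"

text \<open>\<open>descend T i p\<close> follows \<open>p\<close> from node \<open>i\<close> as long as possible and returns the unmatched rest.\<close>

fun descend :: "'a entry list \<Rightarrow> nat \<Rightarrow> 'a list \<Rightarrow> nat \<times> 'a list" where
  "descend T i [] = (i, [])"
| "descend T i (a # p) =
     (if Some (i, a) \<in> set T
      then descend T (length (takeWhile (\<lambda>e. e \<noteq> Some (i, a)) T)) p
      else (i, a # p))"

fun append_path :: "'a entry list \<Rightarrow> nat \<Rightarrow> 'a list \<Rightarrow> 'a entry list" where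
  "append_path T i [] = T"
| "append_path T i (a # p) = append_path (T @ [Some (i, a)]) (length T) p"

text \<open>
  With no marked arcs every label has second component \<open>0\<close>, and the search is
  Dijkstra's algorithm stopped at the target.
\<close>

definition shortest_inst :: "('v, 'a) pre_digraph \<Rightarrow> 'v \<Rightarrow> ('v, 'a) search_inst" where
  "shortest_inst D s = \<lparr>graph = D, source = s, marked = {}, bound = 1\<rparr>"

definition second_inst ::
  "('v, 'a) pre_digraph \<Rightarrow> 'v \<Rightarrow> 'a entry list \<Rightarrow> 'a found_path \<Rightarrow> ('v, 'a) search_inst" where
  "second_inst D s T f =
     (let p = trace T (leaf f); pre = take (dev_len f) p; cur = drop (dev_len f) p;
          D' = D \<restriction> (verts D - tail D ` set pre)
      in \<lparr>graph = D'\<lparr>arcs := arcs D' - set (blocked f)\<rparr>,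
          source = (if pre = [] then s else head D (last pre)),
          marked = set cur, bound = length cur\<rparr>)"

definition next_phase ::
  "('v, 'a) pre_digraph \<Rightarrow> 'v \<Rightarrow> 'a entry list \<Rightarrow> 'a found_path list \<Rightarrow> nat list
   \<Rightarrow> ('v, 'a) phase" where
  "next_phase D s T F js =
     (case js of [] \<Rightarrow> Idle
      | j # js' \<Rightarrow> let I = second_inst D s T (F ! j) in Search (Some j) I (bda_init I) js')"

definition fixed_prefix :: "('v, 'a) config \<Rightarrow> nat \<Rightarrow> 'a list" where
  "fixed_prefix X j = take (dev_len (found X ! j)) (trace (tree X) (leaf (found X ! j)))"

definition kssp_init :: "('v, 'a) pre_digraph \<Rightarrow> 'v \<Rightarrow> ('v, 'a) config" where
  "kssp_init D s =
     \<lparr>tree = [None], found = [], cands = {#},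
      phase = Search None (shortest_inst D s) (bda_init (shortest_inst D s)) []\<rparr>"

inductive kssp_step ::
  "('v, 'a) pre_digraph \<Rightarrow> 'v \<Rightarrow> 'v \<Rightarrow> ('a \<Rightarrow> real) \<Rightarrow> nat
   \<Rightarrow> ('v, 'a) config \<Rightarrow> ('v, 'a) config \<Rightarrow> bool"
  for D :: "('v, 'a) pre_digraph" and s t :: 'v and c :: "'a \<Rightarrow> real" and k :: nat
where
  search:
    "\<lbrakk>phase X = Search j I S js; bda_step I c t S S'\<rbrakk>
     \<Longrightarrow> kssp_step D s t c k X (X\<lparr>phase := Search j I S' js\<rparr>)"
| shortest_found:
    "\<lbrakk>phase X = Search None I S js; control S = Stopped (Some p)\<rbrakk>
     \<Longrightarrow> kssp_step D s t c k X (X\<lparr>phase := Insert None p\<rparr>)"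
| second_found:
    "\<lbrakk>phase X = Search (Some j) I S js; control S = Stopped (Some r)\<rbrakk>
     \<Longrightarrow> kssp_step D s t c k X
          (X\<lparr>cands := add_mset
               \<lparr>cand_cost = awalk_cost c (fixed_prefix X j @ r), cand_parent = j, cand_suffix = r\<rparr>
               (cands X),
             phase := next_phase D s (tree X) (found X) js\<rparr>)"
| second_none:
    "\<lbrakk>phase X = Search (Some j) I S js; control S = Stopped None\<rbrakk>
     \<Longrightarrow> kssp_step D s t c k X (X\<lparr>phase := next_phase D s (tree X) (found X) js\<rparr>)"
| extract_cheapest:
    "\<lbrakk>phase X = Idle; length (found X) < k; x \<in># cands X;
      \<forall>y \<in># cands X. cand_cost x \<le> cand_cost y\<rbrakk>
     \<Longrightarrow> kssp_step D s t c k X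
          (X\<lparr>cands := cands X - {#x#},
             phase := Insert (Some (cand_parent x))
                        (fixed_prefix X (cand_parent x) @ cand_suffix x)\<rparr>)"
| insert_first:
    "\<lbrakk>phase X = Insert None p; T = append_path (tree X) 0 p;
      F = [\<lparr>leaf = length T - 1, dev_len = 0, blocked = []\<rparr>]\<rbrakk>
     \<Longrightarrow> kssp_step D s t c k X (X\<lparr>tree := T, found := F, phase := next_phase D s T F [0]\<rparr>)"
| insert_deviation:
    "\<lbrakk>phase X = Insert (Some j) q; descend (tree X) 0 q = (i, a # r);
      T = append_path (tree X) i (a # r);
      F = (found X)[j := (found X ! j)\<lparr>blocked := a # blocked (found X ! j)\<rparr>]
          @ [\<lparr>leaf = length T - 1, dev_len = length q - length r, blocked = []\<rparr>]\<rbrakk>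
     \<Longrightarrow> kssp_step D s t c k X
          (X\<lparr>tree := T, found := F, phase := next_phase D s T F [length (found X), j]\<rparr>)"

definition kssp_reachable ::
  "('v, 'a) pre_digraph \<Rightarrow> 'v \<Rightarrow> 'v \<Rightarrow> ('a \<Rightarrow> real) \<Rightarrow> nat \<Rightarrow> ('v, 'a) config \<Rightarrow> bool" where
  "kssp_reachable D s t c k X \<longleftrightarrow> (kssp_step D s t c k)\<^sup>*\<^sup>* (kssp_init D s) X"


subsection \<open>Memory\<close>

text \<open>A label is five words: vertex, two cost components, predecessor index and predecessor arc.\<close>

fun control_words :: "('v, 'a) bda_control \<Rightarrow> nat" where
  "control_words Select = 1"
| "control_words (Scan i A b) = 2 + card A + 5"
| "control_words (Propagate i A) = 2 + card A"
| "control_words (Stopped None) = 1"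
| "control_words (Stopped (Some p)) = 1 + length p"

text \<open>The arrays \<open>perm\<close>, \<open>queue\<close> (vertices) and \<open>next_perm\<close> (arcs) take one word per index.\<close>

definition bda_words :: "('v, 'a) pre_digraph \<Rightarrow> ('v, 'a) bda_state \<Rightarrow> nat" where
  "bda_words D S =
     5 * length (labels S)
     + card (verts D) + (\<Sum>v\<in>verts D. length (perm S v))
     + card (verts D) + 5 * card (dom (queue S))
     + card (arcs D)
     + control_words (control S)"

text \<open>
  The subgraph of a search is stored by one flag per vertex and arc of \<open>D\<close>, \<open>marked\<close> by one flag
  per arc; two more words hold source and bound.
\<close>

fun phase_words :: "('v, 'a) pre_digraph \<Rightarrow> ('v, 'a) phase \<Rightarrow> nat" where
  "phase_words D Idle = 1"
| "phase_words D (Search j I S js) =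
     2 + (card (verts D) + 2 * card (arcs D) + 2) + bda_words D S + length js"
| "phase_words D (Insert j q) = 2 + length q"

text \<open>The first line is the input: the vertices, tail, head and cost of each arc, \<open>s\<close>, \<open>t\<close>, \<open>k\<close>.\<close>

definition kssp_words :: "('v, 'a) pre_digraph \<Rightarrow> ('v, 'a) config \<Rightarrow> nat" where
  "kssp_words D X =
     card (verts D) + 3 * card (arcs D) + 3
     + 2 * length (tree X)
     + (\<Sum>f\<leftarrow>found X. 2 + length (blocked f))
     + (\<Sum>x\<in>#cands X. 2 + length (cand_suffix x))
     + phase_words D (phase X)"

end

theory Submission
  imports Defs
begin

text \<open>
  In a search the dominance test makes the number of hits strictly decrease along the labels
  extracted at a vertex, while it never decreases along a path.  Hence label paths are simple, hits
  are at most \<open>n\<close>, each vertex has at most \<open>n + 1\<close> permanent labels, and a search needs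
  \<open>O(n\<^sup>2 + m)\<close> words.  A search runs in the graph without the vertices of the fixed prefix, so
  every stored path is simple too and has at most \<open>n\<close> arcs.  Each of the at most \<open>k\<close> found paths
  adds at most \<open>n\<close> tree nodes, one blocked arc and two candidates, which gives \<open>O(k n)\<close> words.
\<close>

text \<open>The record types declared after the constant \<open>extend\<close> shadow it by their own \<open>extend\<close>.\<close>

hide_const (open) config.extend candidate.extend found_path.extend
hide_fact (open) config.extend_def candidate.extend_def found_path.extend_def

section \<open>Predecessor trees\<close>

text \<open>\<open>trace\<close> only follows pointers to smaller indices, so entries appended
  behind node \<open>i\<close> are never read.\<close>

lemma trace_append: "i < length T \<Longrightarrow> trace (T @ T') i = trace T i"
proof (induction i rule: less_induct)
  case (less i)
  then show ?case
    by (subst (1 2) trace.simps) (auto simp: nth_append split: option.splits)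
qed

lemma trace_None: "T ! i = None \<Longrightarrow> trace T i = []"
  by (subst trace.simps) simp

lemma trace_Some: "T ! i = Some (j, a) \<Longrightarrow> j < i \<Longrightarrow> trace T i = trace T j @ [a]"
  by (subst trace.simps) simp

text \<open>Node \<open>0\<close> is the root, which stands for \<open>s\<close>. The condition on
  pointers keeps the fallback branch of \<open>trace\<close> unreachable.\<close>

definition pred_tree :: "'a entry list \<Rightarrow> bool" where
  "pred_tree T \<longleftrightarrow> T \<noteq> [] \<and> T ! 0 = None \<and> (\<forall>i<length T. \<forall>j a. T ! i = Some (j, a) \<longrightarrow> j < i)"

lemma length_append_path: "length (append_path T i p) = length T + length p"
  by (induction T i p rule: append_path.induct) auto

lemma pred_tree_snoc: "pred_tree T \<Longrightarrow> i < length T \<Longrightarrow> pred_tree (T @ [Some (i, a)])"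
  by (auto simp: pred_tree_def nth_append less_Suc_eq)

lemma pred_tree_append_path: "pred_tree T \<Longrightarrow> i < length T \<Longrightarrow> pred_tree (append_path T i p)"
  by (induction T i p rule: append_path.induct) (auto intro: pred_tree_snoc)

lemma append_path_extends: "\<exists>T'. append_path T i p = T @ T'"
  by (induction T i p rule: append_path.induct) auto

lemma trace_append_path_old: "j < length T \<Longrightarrow> trace (append_path T i p) j = trace T j"
  using append_path_extends[of T i p] by (auto simp: trace_append)

text \<open>The first new arc takes index \<open>length T\<close>, hence the end of the path sits at
  \<open>length T + length p\<close>. The path is nonempty because an empty one creates no
  node.\<close>

lemma trace_append_path_Cons:
  "i < length T \<Longrightarrow>
   trace (append_path T i (a # p)) (length T + length p) = trace T i @ a # p"
proof (induction p arbitrary: T i a)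
  case Nil
  then show ?case by (simp add: trace_Some trace_append)
next
  case (Cons b p)
  let ?T = "T @ [Some (i, a)]"
  have "trace (append_path ?T (length T) (b # p)) (length ?T + length p)
      = trace ?T (length T) @ b # p"
    by (rule Cons.IH) simp
  moreover have "trace ?T (length T) = trace T i @ [a]"
    using Cons.prems by (simp add: trace_Some trace_append)
  ultimately show ?case by simp
qed

text \<open>Each matched arc moves from the remaining path to the trace of the current node, so
  their concatenation is invariant.\<close>

lemma descend_trace:
  assumes "pred_tree T" "i < length T" "descend T i p = (j, r)"
  shows "j < length T \<and> trace T j @ r = trace T i @ p"
  using assms
proof (induction T i p rule: descend.induct)
  case (1 T i)
  then show ?case by simp
next
  case (2 T i a p)
  show ?case
  proof (cases "Some (i, a) \<in> set T")
    case True
    \<comment> \<open>\<open>h\<close> is the first tree node entered from \<open>i\<close> by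
      \<open>a\<close>, to which \<open>descend\<close> moves.\<close>
    define h where "h = length (takeWhile (\<lambda>e. e \<noteq> Some (i, a)) T)"
    have h: "h < length T"
      unfolding h_def using True by (induction T) auto
    have "T ! h = Some (i, a)"
      using nth_length_takeWhile[of "\<lambda>e. e \<noteq> Some (i, a)" T] h by (simp add: h_def)
    then have "trace T h = trace T i @ [a]"
      using 2(2) h by (intro trace_Some) (auto simp: pred_tree_def)
    moreover have "j < length T \<and> trace T j @ r = trace T h @ p"
      using 2 True h by (simp add: h_def)
    ultimately show ?thesis by simp
  next
    case False
    then show ?thesis using 2 by auto
  qed
qed

section \<open>Labels of a search\<close>

text \<open>The last conjunct is all that is used about the dominance test.\<close>

definition valid_label :: "('v, 'a) search_inst \<Rightarrow> ('v, 'a) label list \<Rightarrow> ('v, 'a) label \<Rightarrow> bool" where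
  "valid_label I L l \<longleftrightarrow>
     (case lab_pred l of
        None \<Rightarrow> lab_node l = source I \<and> lab_hits l = 0
      | Some (j, a) \<Rightarrow> j < length L \<and> a \<in> arcs (graph I) \<and> tail (graph I) a = lab_node (L ! j)
          \<and> lab_node l = head (graph I) a
          \<and> lab_hits (L ! j) \<le> lab_hits l \<and> lab_hits l \<le> Suc (lab_hits (L ! j)))
     \<and> (\<forall>i<length L. lab_node (L ! i) = lab_node l \<longrightarrow> lab_hits l < lab_hits (L ! i))"

text \<open>Each label is judged against those extracted before it, so predecessor indices are
  smaller and hits strictly decrease at a vertex.\<close>

definition valid_labels :: "('v, 'a) search_inst \<Rightarrow> ('v, 'a) label list \<Rightarrow> bool" where
  "valid_labels I L \<longleftrightarrow> (\<forall>j<length L. valid_label I (take j L) (L ! j))"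

lemma valid_labels_snoc:
  "valid_labels I (L @ [l]) \<longleftrightarrow> valid_labels I L \<and> valid_label I L l"
  by (auto simp: valid_labels_def nth_append less_Suc_eq)

text \<open>When a label is settled, the queued labels at other vertices stay valid: only labels at
  the same vertex are compared.\<close>

lemma valid_label_snoc:
  "valid_label I L l \<Longrightarrow> lab_node l' \<noteq> lab_node l \<Longrightarrow> valid_label I (L @ [l']) l"
  by (auto simp: valid_label_def nth_append less_Suc_eq split: option.splits)

lemma valid_labels_hits_less:
  "valid_labels I L \<Longrightarrow> i < j \<Longrightarrow> j < length L \<Longrightarrow> lab_node (L ! i) = lab_node (L ! j)
   \<Longrightarrow> lab_hits (L ! j) < lab_hits (L ! i)"
  by (auto simp: valid_labels_def valid_label_def)

text \<open>Induction along predecessor pointers. An arc adds at most one hit, so the path length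
  bounds the hits. The third conjunct strengthens the induction: each tail on the path has an
  earlier label with no more hits, which is what excludes a repeated tail.\<close>

lemma trace_valid_labels:
  assumes "valid_labels I L" "i < length L"
  shows "set (trace (map lab_pred L) i) \<subseteq> arcs (graph I)
    \<and> lab_hits (L ! i) \<le> length (trace (map lab_pred L) i)
    \<and> (\<forall>a\<in>set (trace (map lab_pred L) i). \<exists>j<i. lab_node (L ! j) = tail (graph I) a
          \<and> lab_hits (L ! j) \<le> lab_hits (L ! i))
    \<and> distinct (map (tail (graph I)) (trace (map lab_pred L) i))"
  using assms(2)
proof (induction i rule: less_induct)
  case (less i)
  have v: "valid_label I (take i L) (L ! i)"
    using assms(1) less.prems by (simp add: valid_labels_def)
  show ?case
  proof (cases "lab_pred (L ! i)")
    case None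
    then have "trace (map lab_pred L) i = []"
      using less.prems by (simp add: trace_None)
    then show ?thesis using v None by (simp add: valid_label_def)
  next
    case (Some ja)
    obtain j a where ja: "lab_pred (L ! i) = Some (j, a)" using Some by (cases ja) auto
    have j: "j < i" "a \<in> arcs (graph I)" "tail (graph I) a = lab_node (L ! j)"
      "lab_hits (L ! j) \<le> lab_hits (L ! i)" "lab_hits (L ! i) \<le> Suc (lab_hits (L ! j))"
      using v ja less.prems by (auto simp: valid_label_def)
    have tr: "trace (map lab_pred L) i = trace (map lab_pred L) j @ [a]"
      using ja j(1) less.prems by (simp add: trace_Some)
    note IH = less.IH[OF j(1) less_trans[OF j(1) less.prems]]
    \<comment> \<open>A repetition would give a label \<open>h < j\<close> at the vertex of
      \<open>j\<close> with no more hits than \<open>j\<close>, although hits strictly decrease at a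
      vertex.\<close>
    have "tail (graph I) a \<notin> tail (graph I) ` set (trace (map lab_pred L) j)"
    proof
      assume "tail (graph I) a \<in> tail (graph I) ` set (trace (map lab_pred L) j)"
      then obtain h where "h < j" "lab_node (L ! h) = lab_node (L ! j)"
        "lab_hits (L ! h) \<le> lab_hits (L ! j)"
        using IH j(3) by fastforce
      then show False
        using valid_labels_hits_less[OF assms(1), of h j] j(1) less.prems by simp
    qed
    moreover have "\<exists>h<i. lab_node (L ! h) = tail (graph I) b \<and> lab_hits (L ! h) \<le> lab_hits (L ! i)"
      if "b \<in> set (trace (map lab_pred L) i)" for b
    proof (cases "b = a")
      case True
      then show ?thesis using j by auto
    next
      case False
      then have "b \<in> set (trace (map lab_pred L) j)" using that tr by simp
      then obtain h where "h < j" "lab_node (L ! h) = tail (graph I) b"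
        "lab_hits (L ! h) \<le> lab_hits (L ! j)"
        using IH by blast
      then show ?thesis using j by (intro exI[of _ h]) simp
    qed
    ultimately show ?thesis using IH j unfolding tr by auto
  qed
qed

section \<open>The search invariant\<close>

fun control_inv :: "('v, 'a) search_inst \<Rightarrow> ('v, 'a) label list \<Rightarrow> ('v, 'a) bda_control \<Rightarrow> bool" where
  "control_inv I L Select \<longleftrightarrow> True"
| "control_inv I L (Scan i A b) \<longleftrightarrow> i < length L \<and> A \<subseteq> in_arcs (graph I) (lab_node (L ! i))
     \<and> pred_option (\<lambda>l. valid_label I L l \<and> lab_node l = lab_node (L ! i)) b"
| "control_inv I L (Propagate i A) \<longleftrightarrow> i < length L \<and> A \<subseteq> out_arcs (graph I) (lab_node (L ! i))"
| "control_inv I L (Stopped None) \<longleftrightarrow> True"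
| "control_inv I L (Stopped (Some p)) \<longleftrightarrow>
     set p \<subseteq> arcs (graph I) \<and> distinct (map (tail (graph I)) p)"

text \<open>\<open>perm\<close> is pinned down as a function of \<open>labels\<close>, so its
  lengths and last entries can be computed from the label list.\<close>

definition bda_inv :: "('v, 'a) search_inst \<Rightarrow> ('v, 'a) bda_state \<Rightarrow> bool" where
  "bda_inv I S \<longleftrightarrow>
     valid_labels I (labels S)
     \<and> (\<forall>v. perm S v = filter (\<lambda>i. lab_node (labels S ! i) = v) [0..<length (labels S)])
     \<and> (\<forall>v l. queue S v = Some l \<longrightarrow> valid_label I (labels S) l \<and> lab_node l = v)
     \<and> control_inv I (labels S) (control S)"

text \<open>For the \<open>settle\<close> step, which changes four fields at once; the equations let
  the new fields be named separately.\<close>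

lemma bda_invI:
  assumes "labels S = L" "perm S = p" "queue S = Q" "control S = K"
    and "valid_labels I L"
    and "\<And>v. p v = filter (\<lambda>i. lab_node (L ! i) = v) [0..<length L]"
    and "\<And>v l. Q v = Some l \<Longrightarrow> valid_label I L l \<and> lab_node l = v"
    and "control_inv I L K"
  shows "bda_inv I S"
  unfolding bda_inv_def assms(1-4) using assms(5-8) by blast

lemma bda_inv_init: "bda_inv I (bda_init I)"
  by (auto simp: bda_inv_def bda_init_def valid_labels_def valid_label_def)

section \<open>Labels that pass the dominance test\<close>

lemma last_filter_upt_max:
  assumes "i < n" "P i"
  shows "i \<le> last (filter P [0..<n]) \<and> last (filter P [0..<n]) < n \<and> P (last (filter P [0..<n]))"
  using assms by (induction n) (auto simp: less_Suc_eq)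

text \<open>The test looks only at the last permanent label of a vertex. Since hits strictly
  decrease there, that label has the fewest, and beating it means beating all.\<close>

lemma valid_label_extend:
  assumes "bda_inv I S" "i < length (labels S)" "a \<in> arcs (graph I)"
    "lab_node (labels S ! i) = tail (graph I) a" "\<not> dominated t S (extend I c S i a)"
  shows "valid_label I (labels S) (extend I c S i a)"
proof -
  let ?l = "extend I c S i a" and ?L = "labels S"
  let ?v = "lab_node ?l"
  have "lab_hits ?l < lab_hits (?L ! h)" if h: "h < length ?L" "lab_node (?L ! h) = ?v" for h
  proof -
    \<comment> \<open>The label settled most recently at the head of \<open>a\<close>.\<close>
    let ?m = "last (perm S ?v)"
    have perm: "perm S ?v = filter (\<lambda>i. lab_node (?L ! i) = ?v) [0..<length ?L]"
      using assms(1) by (simp add: bda_inv_def)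
    have m: "h \<le> ?m" "?m < length ?L" "lab_node (?L ! ?m) = ?v"
      using last_filter_upt_max[of h "length ?L" "\<lambda>i. lab_node (?L ! i) = ?v"] h
      by (simp_all add: perm)
    have "h \<in> set (perm S ?v)" using h by (simp add: perm)
    then have "perm S ?v \<noteq> []" by auto
    then have "lab_hits ?l < lab_hits (?L ! ?m)"
      using assms(5) by (auto simp: dominated_def)
    also have "\<dots> \<le> lab_hits (?L ! h)"
    proof (cases "h = ?m")
      case False
      then show ?thesis
        using valid_labels_hits_less[of I ?L h ?m] assms(1) m h by (simp add: bda_inv_def)
    qed simp
    finally show ?thesis .
  qed
  then show ?thesis
    using assms(2-4) by (auto simp: valid_label_def extend_def)
qed

lemma lex_better_pred: "pred_option P x \<Longrightarrow> P l \<Longrightarrow> pred_option P (Some (lex_better x l))"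
  by (auto simp: lex_better_def split: option.splits)

section \<open>Preservation of the search invariant\<close>

lemma bda_inv_control_update:
  "bda_inv I S \<Longrightarrow> control_inv I (labels S) K \<Longrightarrow> bda_inv I (S\<lparr>control := K\<rparr>)"
  by (simp add: bda_inv_def)

lemma bda_inv_next_perm_update: "bda_inv I S \<Longrightarrow> bda_inv I (S\<lparr>next_perm := f\<rparr>)"
  by (simp add: bda_inv_def)

lemma bda_inv_queue_update:
  "bda_inv I S \<Longrightarrow> (\<And>l. x = Some l \<Longrightarrow> valid_label I (labels S) l \<and> lab_node l = v)
   \<Longrightarrow> bda_inv I (S\<lparr>queue := (queue S)(v := x)\<rparr>)"
  by (simp add: bda_inv_def)

lemma bda_inv_control: "bda_inv I S \<Longrightarrow> control S = K \<Longrightarrow> control_inv I (labels S) K"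
  by (auto simp: bda_inv_def)

lemma bda_inv_queue:
  "bda_inv I S \<Longrightarrow> queue S v = Some l \<Longrightarrow> valid_label I (labels S) l \<and> lab_node l = v"
  by (simp add: bda_inv_def)

lemma bda_step_inv:
  assumes "bda_step I c t S S'" "bda_inv I S"
  shows "bda_inv I S'"
  using assms
proof (induction rule: bda_step.induct)
  case (accept S l)
  \<comment> \<open>\<open>label_path\<close> appends \<open>l\<close> to the permanent labels, so
    the accepted label is treated as if it were settled.\<close>
  let ?L = "labels S @ [l]"
  have "valid_labels I ?L"
    using accept by (auto simp: bda_inv_def valid_labels_snoc lex_min_queue_def)
  from trace_valid_labels[OF this, of "length (labels S)"] show ?case
    using accept.prems by (simp add: bda_inv_def label_path_def)
next
  case (exhausted S)
  then show ?case by (simp add: bda_inv_def)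
next
  case (settle S v l)
  let ?n = "length (labels S)" and ?L = "labels S @ [l]"
  have l: "valid_label I (labels S) l" "lab_node l = v"
    using bda_inv_queue[OF settle.prems, of v l] settle.hyps(2) by (simp_all add: lex_min_queue_def)
  have labels: "valid_labels I ?L"
    using settle.prems l(1) by (simp add: bda_inv_def valid_labels_snoc)
  have perm: "((perm S)(v := perm S v @ [?n])) w
      = filter (\<lambda>i. lab_node (?L ! i) = w) [0..<length ?L]" for w
  proof -
    have "perm S w = filter (\<lambda>i. lab_node (labels S ! i) = w) [0..<?n]"
      using settle.prems by (simp add: bda_inv_def)
    also have "\<dots> = filter (\<lambda>i. lab_node (?L ! i) = w) [0..<?n]"
      by (rule filter_cong) (auto simp: nth_append)
    finally show ?thesis using l(2) by (cases "w = v") simp_all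
  qed
  \<comment> \<open>The entry of \<open>v\<close> is cleared, so every remaining queue label lies at
    another vertex than \<open>l\<close>.\<close>
  have queue: "valid_label I ?L l' \<and> lab_node l' = w"
    if "((queue S)(v := None)) w = Some l'" for w l'
    using that l(2) bda_inv_queue[OF settle.prems, of w l']
    by (auto intro: valid_label_snoc split: if_splits)
  have control: "control_inv I ?L (Scan ?n (in_arcs (graph I) v) None)"
    using l(2) by simp
  show ?case
  proof (rule bda_invI[OF _ _ _ _ labels perm _ control])
    fix w l' assume "((queue S)(v := None)) w = Some l'"
    then show "valid_label I ?L l' \<and> lab_node l' = w" by (rule queue)
  qed (simp_all add: fun_upd_def)
next
  case (scan_none S i A b a)
  from bda_inv_control[OF scan_none.prems scan_none.hyps(1)] show ?case
    by (intro bda_inv_control_update scan_none.prems) auto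
next
  case (scan_dominated S i A b a l)
  show ?case by (intro bda_inv_next_perm_update scan_dominated.prems)
next
  case (scan_candidate S i A b a l)
  let ?u = "tail (graph I) a"
  \<comment> \<open>The guard on \<open>next_perm\<close> keeps the lookup inside
    \<open>perm S ?u\<close>, which lists labels at the tail of \<open>a\<close>.\<close>
  have "perm S ?u ! next_perm S a \<in> set (perm S ?u)"
    using scan_candidate.hyps(3) by simp
  moreover have "perm S ?u = filter (\<lambda>i. lab_node (labels S ! i) = ?u) [0..<length (labels S)]"
    using scan_candidate.prems by (simp add: bda_inv_def)
  ultimately have p: "perm S ?u ! next_perm S a < length (labels S)"
    "lab_node (labels S ! (perm S ?u ! next_perm S a)) = ?u"
    by simp_all
  note control = bda_inv_control[OF scan_candidate.prems scan_candidate.hyps(1)]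
  then have a: "a \<in> in_arcs (graph I) (lab_node (labels S ! i))"
    using scan_candidate.hyps(2) by auto
  then have "valid_label I (labels S) l"
    using valid_label_extend[OF scan_candidate.prems p(1) _ p(2)] scan_candidate.hyps(4,5) by simp
  moreover have "lab_node l = lab_node (labels S ! i)"
    using a scan_candidate.hyps(4) by (simp add: extend_def)
  ultimately have "pred_option
      (\<lambda>l. valid_label I (labels S) l \<and> lab_node l = lab_node (labels S ! i)) (Some (lex_better b l))"
    using control by (intro lex_better_pred) simp_all
  then show ?case
    using control by (intro bda_inv_control_update scan_candidate.prems) auto
next
  case (scan_done S i b v)
  note control = bda_inv_control[OF scan_done.prems scan_done.hyps(1)]
  have "bda_inv I (S\<lparr>queue := (queue S)(v := b)\<rparr>)"
    using control scan_done.hyps(2)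
    by (intro bda_inv_queue_update scan_done.prems) (simp add: option.pred_set)
  from bda_inv_control_update[OF this, of "Propagate i (out_arcs (graph I) v)"] show ?case
    using control scan_done.hyps(2) by simp
next
  case (propagate_dominated S i A a)
  from bda_inv_control[OF propagate_dominated.prems propagate_dominated.hyps(1)] show ?case
    by (intro bda_inv_control_update propagate_dominated.prems) auto
next
  case (propagate_queue S i A a l w)
  note control = bda_inv_control[OF propagate_queue.prems propagate_queue.hyps(1)]
  then have a: "i < length (labels S)" "a \<in> arcs (graph I)"
    "lab_node (labels S ! i) = tail (graph I) a"
    using propagate_queue.hyps(2) by auto
  have "valid_label I (labels S) l"
    using valid_label_extend[OF propagate_queue.prems a] propagate_queue.hyps(3,4) by simp
  moreover have "lab_node l = w"
    using propagate_queue.hyps(3,5) by (simp add: extend_def)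
  ultimately have "bda_inv I (S\<lparr>queue := (queue S)(w := Some (lex_better (queue S w) l))\<rparr>)"
    using bda_inv_queue[OF propagate_queue.prems, of w]
      lex_better_pred[of "\<lambda>l. valid_label I (labels S) l \<and> lab_node l = w" "queue S w" l]
    by (intro bda_inv_queue_update propagate_queue.prems) (auto simp: option.pred_set)
  from bda_inv_control_update[OF this, of "Propagate i (A - {a})"] show ?case
    using control by auto
next
  case (propagate_done S i)
  show ?case by (intro bda_inv_control_update propagate_done.prems) simp
qed

section \<open>Memory of a search\<close>

text \<open>Distinct tails are the form of simplicity that bounds the length by the number of
  vertices and splits over concatenation.\<close>

definition tail_simple :: "('v, 'a) pre_digraph \<Rightarrow> 'a list \<Rightarrow> bool" where
  "tail_simple D p \<longleftrightarrow> set p \<subseteq> arcs D \<and> distinct (map (tail D) p)"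

lemma (in fin_digraph) length_tail_simple:
  assumes "tail_simple G p"
  shows "length p \<le> card (verts G)"
proof -
  have "length p = card (set (map (tail G) p))"
    using assms by (metis distinct_card length_map tail_simple_def)
  also have "\<dots> \<le> card (verts G)"
    using assms by (intro card_mono) (auto simp: tail_simple_def)
  finally show ?thesis .
qed

text \<open>Endpoint maps are kept and only arcs are lost, so label nodes and simple paths of the
  search are also ones of \<open>D\<close>.\<close>

definition sub_inst :: "('v, 'a) pre_digraph \<Rightarrow> ('v, 'a) search_inst \<Rightarrow> bool" where
  "sub_inst D I \<longleftrightarrow> arcs (graph I) \<subseteq> arcs D \<and> tail (graph I) = tail D \<and> head (graph I) = head D
     \<and> source I \<in> verts D"

lemma (in fin_digraph) valid_label_node:
  "sub_inst G I \<Longrightarrow> valid_label I L l \<Longrightarrow> lab_node l \<in> verts G"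
  by (auto simp: sub_inst_def valid_label_def split: option.splits)

text \<open>Labels at one vertex have pairwise different hits, all in \<open>{0..n}\<close> because
  label paths are simple.\<close>

lemma (in fin_digraph) length_perm_le:
  assumes "sub_inst G I" "bda_inv I S"
  shows "length (perm S v) \<le> Suc (card (verts G))"
proof -
  let ?L = "labels S"
  let ?P = "{i. i < length ?L \<and> lab_node (?L ! i) = v}"
  have valid: "valid_labels I ?L" using assms(2) by (simp add: bda_inv_def)
  have "perm S v = filter (\<lambda>i. lab_node (?L ! i) = v) [0..<length ?L]"
    using assms(2) by (simp add: bda_inv_def)
  then have "length (perm S v) = card ?P"
    by (simp add: distinct_card[symmetric] conj_commute)
  also have "\<dots> \<le> card {..card (verts G)}"
  proof (rule card_inj_on_le)
    show "inj_on (\<lambda>i. lab_hits (?L ! i)) ?P"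
      by (rule linorder_inj_onI') (use valid_labels_hits_less[OF valid] in fastforce)
    show "(\<lambda>i. lab_hits (?L ! i)) ` ?P \<subseteq> {..card (verts G)}"
    proof clarsimp
      fix i assume i: "i < length ?L"
      let ?p = "trace (map lab_pred ?L) i"
      have "tail_simple G ?p" "lab_hits (?L ! i) \<le> length ?p"
        using trace_valid_labels[OF valid i] assms(1) by (auto simp: tail_simple_def sub_inst_def)
      then show "lab_hits (?L ! i) \<le> card (verts G)"
        using length_tail_simple by fastforce
    qed
  qed simp
  finally show ?thesis by simp
qed

lemma (in fin_digraph) sum_length_perm:
  assumes "sub_inst G I" "bda_inv I S"
  shows "(\<Sum>v\<in>verts G. length (perm S v)) = length (labels S)"
proof -
  let ?L = "labels S"
  have nodes: "lab_node (?L ! i) \<in> verts G" if "i < length ?L" for i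
    using assms that valid_label_node[OF assms(1)] by (auto simp: bda_inv_def valid_labels_def)
  have "perm S v = filter (\<lambda>i. lab_node (?L ! i) = v) [0..<length ?L]" for v
    using assms(2) by (simp add: bda_inv_def)
  then have "length (perm S v) = card {i \<in> {..<length ?L}. lab_node (?L ! i) = v}" for v
    by (simp add: distinct_card[symmetric] conj_commute)
  then have "(\<Sum>v\<in>verts G. length (perm S v))
      = (\<Sum>v\<in>verts G. card {i \<in> {..<length ?L}. lab_node (?L ! i) = v})"
    by simp
  \<comment> \<open>Double counting: each label lies at exactly one vertex.\<close>
  also have "\<dots> = (\<Sum>i<length ?L. card {v \<in> verts G. lab_node (?L ! i) = v})"
    by (rule sum_multicount_gen) simp_all
  also have "\<dots> = (\<Sum>i<length ?L. 1)"
  proof (rule sum.cong)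
    fix i assume "i \<in> {..<length ?L}"
    then have "{v \<in> verts G. lab_node (?L ! i) = v} = {lab_node (?L ! i)}"
      using nodes by auto
    then show "card {v \<in> verts G. lab_node (?L ! i) = v} = 1" by simp
  qed simp
  finally show ?thesis by simp
qed

text \<open>There are at most \<open>n * (n + 1)\<close> labels at six words each, counting their
  \<open>perm\<close> entries. The queue adds \<open>5 * n\<close>, the two vertex arrays
  \<open>2 * n\<close> and a returned path \<open>n\<close>; \<open>next_perm\<close> and the arcs
  still to be visited give \<open>2 * card (arcs G)\<close>.\<close>

lemma (in fin_digraph) bda_words_le:
  assumes "sub_inst G I" "bda_inv I S"
  defines "n \<equiv> card (verts G)"
  shows "bda_words G S \<le> 6 * n\<^sup>2 + 14 * n + 2 * card (arcs G) + 7"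
proof -
  have "length (labels S) \<le> n * Suc n"
    using sum_bounded_above[of "verts G" "\<lambda>v. length (perm S v)" "Suc n"]
      length_perm_le[OF assms(1,2)] sum_length_perm[OF assms(1,2)]
    by (simp add: n_def)
  moreover have "card (dom (queue S)) \<le> n"
    unfolding n_def using assms(2) valid_label_node[OF assms(1)]
    by (intro card_mono) (force simp: bda_inv_def)+
  moreover have "control_words (control S) \<le> 7 + card (arcs G) + n"
  proof -
    have inv: "control_inv I (labels S) (control S)" using assms(2) by (simp add: bda_inv_def)
    have arcs: "card A \<le> card (arcs G)" if "A \<subseteq> arcs (graph I)" for A
      using that assms(1) by (intro card_mono) (auto simp: sub_inst_def)
    show ?thesis
    proof (cases "control S")
      case (Scan i A b)
      then have "A \<subseteq> arcs (graph I)" using inv by auto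
      from arcs[OF this] show ?thesis using Scan by simp
    next
      case (Propagate i A)
      then have "A \<subseteq> arcs (graph I)" using inv by auto
      from arcs[OF this] show ?thesis using Propagate by simp
    next
      case (Stopped r)
      show ?thesis
      proof (cases r)
        case (Some p)
        then have "tail_simple G p"
          using inv Stopped assms(1) by (auto simp: tail_simple_def sub_inst_def)
        then show ?thesis using length_tail_simple[of p] Some Stopped by (simp add: n_def)
      qed (use Stopped in simp)
    qed simp
  qed
  ultimately show ?thesis
    using sum_length_perm[OF assms(1,2)]
    unfolding bda_words_def by (simp add: n_def power2_eq_square)
qed


section \<open>The Roditty--Zwick invariant\<close>

text \<open>Second-path searches running or scheduled, each of which yields at most one candidate.
  The initial search counts \<open>0\<close>: its result goes directly to the tree.\<close>

fun pending :: "('v, 'a) phase \<Rightarrow> nat" where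
  "pending (Search (Some j) I S js) = Suc (length js)"
| "pending _ = 0"

text \<open>The phase is a separate argument so that a new phase can be examined before it is
  stored. Disjointness of tails makes prefix plus search result simple.\<close>

fun phase_inv :: "('v, 'a) pre_digraph \<Rightarrow> nat \<Rightarrow> ('v, 'a) config \<Rightarrow> ('v, 'a) phase \<Rightarrow> bool" where
  "phase_inv D k X Idle \<longleftrightarrow> True"
| "phase_inv D k X (Search j I S js) \<longleftrightarrow>
     sub_inst D I \<and> bda_inv I S \<and> length js \<le> 1 \<and> (\<forall>i\<in>set js. i < length (found X))
     \<and> (case j of
          None \<Rightarrow> found X = [] \<and> tree X = [None]
        | Some i \<Rightarrow> i < length (found X)
            \<and> tail D ` arcs (graph I) \<inter> tail D ` set (fixed_prefix X i) = {})"
| "phase_inv D k X (Insert None q) \<longleftrightarrow> found X = [] \<and> tree X = [None] \<and> tail_simple D q"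
| "phase_inv D k X (Insert (Some j) q) \<longleftrightarrow>
     j < length (found X) \<and> length (found X) < k \<and> tail_simple D q"

text \<open>The tree bound is the root plus at most \<open>n\<close> nodes per found path; each
  insertion blocks at most one arc.\<close>

definition found_inv :: "('v, 'a) pre_digraph \<Rightarrow> 'a entry list \<Rightarrow> 'a found_path list \<Rightarrow> bool" where
  "found_inv D T F \<longleftrightarrow>
     pred_tree T \<and> length T \<le> Suc (card (verts D) * length F)
     \<and> (\<forall>f\<in>set F. leaf f < length T \<and> tail_simple D (trace T (leaf f)))
     \<and> (\<Sum>f\<leftarrow>F. length (blocked f)) \<le> length F"

text \<open>The sum of candidates and pending searches is a potential: an insertion raises the right
  side by two and schedules at most two searches, and a finished search becomes at most one
  candidate.\<close>

definition kssp_inv :: "('v, 'a) pre_digraph \<Rightarrow> nat \<Rightarrow> ('v, 'a) config \<Rightarrow> bool" where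
  "kssp_inv D k X \<longleftrightarrow>
     found_inv D (tree X) (found X) \<and> length (found X) \<le> k
     \<and> (\<forall>x\<in>#cands X. cand_parent x < length (found X)
          \<and> tail_simple D (fixed_prefix X (cand_parent x) @ cand_suffix x))
     \<and> size (cands X) + pending (phase X) \<le> 2 * length (found X)
     \<and> phase_inv D k X (phase X)"

section \<open>Simple paths and the start of second-path searches\<close>

lemma tail_simple_append:
  "tail_simple D (p @ q) \<longleftrightarrow>
     tail_simple D p \<and> tail_simple D q \<and> tail D ` set p \<inter> tail D ` set q = {}"
  by (auto simp: tail_simple_def)

lemma tail_simple_take: "tail_simple D p \<Longrightarrow> tail_simple D (take i p)"
  by (metis append_take_drop_id tail_simple_append)

lemma tail_simple_fixed_prefix:
  "found_inv D (tree X) (found X) \<Longrightarrow> j < length (found X) \<Longrightarrow> tail_simple D (fixed_prefix X j)"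
  by (simp add: found_inv_def fixed_prefix_def tail_simple_take)

lemma sub_inst_second_inst:
  assumes "wf_digraph D" "s \<in> verts D" "tail_simple D (trace T (leaf f))"
  shows "sub_inst D (second_inst D s T f)"
proof -
  let ?pre = "take (dev_len f) (trace T (leaf f))"
  \<comment> \<open>Makes the head of the last prefix arc, the source of the search, a vertex of
    \<open>D\<close>.\<close>
  have "?pre \<noteq> [] \<Longrightarrow> last ?pre \<in> arcs D"
    using assms(3) by (metis last_in_set set_take_subset subsetD tail_simple_def)
  then show ?thesis
    using assms(1,2)
    by (auto simp: sub_inst_def second_inst_def Let_def wf_digraph.head_in_verts)
qed

lemma phase_inv_next_phase:
  assumes "wf_digraph D" "s \<in> verts D" "found_inv D (tree X) (found X)"
    "\<forall>j\<in>set js. j < length (found X)" "length js \<le> 2"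
  shows "phase_inv D k X (next_phase D s (tree X) (found X) js)"
proof (cases js)
  case (Cons j js')
  then have "sub_inst D (second_inst D s (tree X) (found X ! j))"
    using assms by (intro sub_inst_second_inst) (auto simp: found_inv_def)
  \<comment> \<open>The tails of the prefix are deleted as vertices, so no arc of the induced
    subgraph starts there.\<close>
  moreover have "tail D ` arcs (graph (second_inst D s (tree X) (found X ! j)))
      \<inter> tail D ` set (fixed_prefix X j) = {}"
    by (auto simp: second_inst_def Let_def fixed_prefix_def)
  ultimately show ?thesis
    using Cons assms(4,5) by (simp add: next_phase_def Let_def bda_inv_init)
qed (simp add: next_phase_def)

lemma pending_next_phase: "pending (next_phase D s T F js) = length js"
  by (auto simp: next_phase_def Let_def split: list.split)

lemma fixed_prefix_update [simp]:
  "fixed_prefix (X\<lparr>phase := P\<rparr>) = fixed_prefix X"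
  "fixed_prefix (X\<lparr>cands := M\<rparr>) = fixed_prefix X"
  by (auto simp: fixed_prefix_def)

lemma phase_inv_update [simp]:
  "phase_inv D k (X\<lparr>phase := P\<rparr>) = phase_inv D k X"
  "phase_inv D k (X\<lparr>cands := M\<rparr>) = phase_inv D k X"
proof -
  show "phase_inv D k (X\<lparr>phase := P\<rparr>) = phase_inv D k X"
  proof
    show "phase_inv D k (X\<lparr>phase := P\<rparr>) Q = phase_inv D k X Q" for Q
      by (cases "(D, k, X, Q)" rule: phase_inv.cases) (auto split: option.splits)
  qed
  show "phase_inv D k (X\<lparr>cands := M\<rparr>) = phase_inv D k X"
  proof
    show "phase_inv D k (X\<lparr>cands := M\<rparr>) Q = phase_inv D k X Q" for Q
      by (cases "(D, k, X, Q)" rule: phase_inv.cases) (auto split: option.splits)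
  qed
qed

lemma sub_inst_tail_simple:
  "sub_inst D I \<Longrightarrow> set p \<subseteq> arcs (graph I) \<Longrightarrow> distinct (map (tail (graph I)) p) \<Longrightarrow> tail_simple D p"
  by (auto simp: sub_inst_def tail_simple_def)

section \<open>Preservation of the invariant of the whole algorithm\<close>

lemma kssp_inv_init: "s \<in> verts D \<Longrightarrow> kssp_inv D k (kssp_init D s)"
  by (auto simp: kssp_inv_def kssp_init_def found_inv_def pred_tree_def sub_inst_def
      shortest_inst_def bda_inv_init)

lemma kssp_step_inv:
  assumes "fin_digraph D" "s \<in> verts D" "1 \<le> k" "kssp_step D s t c k X X'" "kssp_inv D k X"
  shows "kssp_inv D k X'"
  using assms(4,5)
proof (induction rule: kssp_step.induct)
  interpret fin_digraph D by fact
  case (search X j I S js S')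
  then show ?case
    by (cases j) (auto simp: kssp_inv_def dest: bda_step_inv)
next
  case (shortest_found X I S js p)
  then show ?case
    by (auto simp: kssp_inv_def bda_inv_def intro: sub_inst_tail_simple)
next
  interpret fin_digraph D by fact
  case (second_found X j I S js r)
  then have inv: "found_inv D (tree X) (found X)" "sub_inst D I" "bda_inv I S"
      "j < length (found X)" "tail D ` arcs (graph I) \<inter> tail D ` set (fixed_prefix X j) = {}"
      "\<forall>i\<in>set js. i < length (found X)" "length js \<le> 1"
    by (auto simp: kssp_inv_def)
  have r: "set r \<subseteq> arcs (graph I)" "tail_simple D r"
    using inv(2,3) second_found.hyps by (auto simp: bda_inv_def intro: sub_inst_tail_simple)
  have "tail_simple D (fixed_prefix X j @ r)"
    using tail_simple_fixed_prefix[OF inv(1,4)] inv(5) r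
    unfolding tail_simple_append by blast
  moreover have "phase_inv D k X (next_phase D s (tree X) (found X) js)"
    using inv assms(2) by (intro phase_inv_next_phase) (auto intro: wf_digraph)
  ultimately show ?case
    using second_found inv(4)
    by (auto simp: kssp_inv_def pending_next_phase)
next
  interpret fin_digraph D by fact
  case (second_none X j I S js)
  then have "phase_inv D k X (next_phase D s (tree X) (found X) js)"
    using assms(2) by (intro phase_inv_next_phase) (auto simp: kssp_inv_def intro: wf_digraph)
  then show ?case
    using second_none
    by (auto simp: kssp_inv_def pending_next_phase)
next
  case (extract_cheapest X x)
  then show ?case
    by (auto simp: kssp_inv_def size_Diff_singleton dest: in_diffD)
next
  interpret fin_digraph D by fact
  case (insert_first X p T F)
  \<comment> \<open>No path has been found yet, so the potential bound forces \<open>cands X\<close>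
    to be empty.\<close>
  then have p: "tree X = [None]" "tail_simple D p" "cands X = {#}"
    by (auto simp: kssp_inv_def)
  have len: "length T = Suc (length p)"
    using insert_first p by (simp add: length_append_path)
  have "pred_tree T"
    unfolding insert_first.hyps p(1) by (rule pred_tree_append_path) (simp_all add: pred_tree_def)
  moreover have "trace T (length p) = p"
  proof (cases p)
    \<comment> \<open>The tree stays \<open>[None]\<close> and the leaf is the root.\<close>
    case Nil
    then show ?thesis using insert_first p by (simp add: trace_None)
  next
    case (Cons a r)
    then show ?thesis
      using trace_append_path_Cons[of 0 "[None]" a r] insert_first p by (simp add: trace_None)
  qed
  ultimately have "found_inv D T F"
    using insert_first p length_tail_simple[OF p(2)] len by (simp add: found_inv_def)
  moreover from this have "phase_inv D k (X\<lparr>tree := T, found := F\<rparr>) (next_phase D s T F [0])"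
    using phase_inv_next_phase[of D s "X\<lparr>tree := T, found := F\<rparr>" "[0]" k] assms(2)
      insert_first wf_digraph by simp
  ultimately show ?case
    using p(3) assms(3) insert_first.hyps
    by (simp add: kssp_inv_def pending_next_phase)
next
  interpret fin_digraph D by fact
  case (insert_deviation X j q i a r T F)
  then have inv: "found_inv D (tree X) (found X)" "j < length (found X)" "length (found X) < k"
      "tail_simple D q"
    by (auto simp: kssp_inv_def)
  have tree: "pred_tree (tree X)" using inv(1) by (simp add: found_inv_def)
  then have "0 < length (tree X)" "trace (tree X) 0 = []"
    by (auto simp: pred_tree_def trace_None)
  then have i: "i < length (tree X)" "trace (tree X) i @ a # r = q"
    using descend_trace[OF tree _ insert_deviation.hyps(2)] by auto
  have len: "length T = length (tree X) + Suc (length r)"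
    using insert_deviation by (simp add: length_append_path)
  have leaf: "trace T (length (tree X) + length r) = q"
    using trace_append_path_Cons[OF i(1), of a r] i(2) insert_deviation by simp
  have old: "trace T h = trace (tree X) h" if "h < length (tree X)" for h
    using that unfolding insert_deviation.hyps(3) by (rule trace_append_path_old)
  let ?f = "found X ! j"
  let ?F = "(found X)[j := ?f\<lparr>blocked := a # blocked ?f\<rparr>]"
  \<comment> \<open>Blocking an arc changes neither \<open>leaf\<close> nor \<open>dev_len\<close>,
    so the fixed prefixes of older paths survive.\<close>
  have F: "leaf (F ! h) = leaf (found X ! h)" "dev_len (F ! h) = dev_len (found X ! h)"
    if "h < length (found X)" for h
    using that inv(2) insert_deviation.hyps(4) by (auto simp: nth_append nth_list_update)
  have lenF: "length F = Suc (length (found X))" using insert_deviation by simp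
  \<comment> \<open>The new tree nodes belong to a suffix of the simple path \<open>q\<close>, so
    there are at most \<open>n\<close>.\<close>
  have "Suc (length r) \<le> length q" using arg_cong[OF i(2), of length] by simp
  then have "Suc (length r) \<le> card (verts D)"
    using length_tail_simple[OF inv(4)] by simp
  then have "length T \<le> Suc (card (verts D) * length F)"
    using inv(1) len lenF by (simp add: found_inv_def)
  moreover have "pred_tree T"
    using insert_deviation tree i(1) by (auto intro!: pred_tree_append_path simp del: append_path.simps)
  moreover have "leaf f < length T \<and> tail_simple D (trace T (leaf f))" if f: "f \<in> set F" for f
  proof -
    obtain h where h: "h < Suc (length (found X))" "f = F ! h"
      using f lenF by (metis in_set_conv_nth)
    show ?thesis
    proof (cases "h < length (found X)")
      case True
      then have "leaf (found X ! h) < length (tree X)"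
        "tail_simple D (trace (tree X) (leaf (found X ! h)))"
        using inv(1) by (auto simp: found_inv_def)
      then show ?thesis using F[OF True] h old len by simp
    next
      case False
      then have "leaf f = length T - 1"
        using h insert_deviation by (simp add: nth_append)
      then show ?thesis using len leaf inv(4) by simp
    qed
  qed
  moreover have "(\<Sum>f\<leftarrow>F. length (blocked f)) \<le> length F"
  proof -
    have "(\<Sum>f\<leftarrow>?F. length (blocked f)) = Suc (\<Sum>f\<leftarrow>found X. length (blocked f))"
      using inv(2) elem_le_sum_list[of j "map (\<lambda>f. length (blocked f)) (found X)"]
      by (simp add: map_update sum_list_update)
    then show ?thesis using inv(1) insert_deviation by (simp add: found_inv_def)
  qed
  ultimately have found: "found_inv D T F"
    by (simp add: found_inv_def)
  let ?X = "X\<lparr>tree := T, found := F\<rparr>"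
  have "phase_inv D k ?X (next_phase D s T F [length (found X), j])"
    using phase_inv_next_phase[of D s ?X "[length (found X), j]" k] assms(2) found lenF inv(2)
      wf_digraph by simp
  \<comment> \<open>Hence stored candidates still stand for the same simple paths.\<close>
  moreover have "fixed_prefix (?X\<lparr>phase := P\<rparr>) h = fixed_prefix X h" if "h < length (found X)" for h P
    using that F old inv(1) by (simp add: fixed_prefix_def found_inv_def)
  ultimately show ?case
    using insert_deviation.prems insert_deviation.hyps(1) found lenF inv(3)
    by (auto simp: kssp_inv_def pending_next_phase less_Suc_eq)
qed

lemma kssp_reachable_inv:
  assumes "fin_digraph D" "s \<in> verts D" "1 \<le> k" "kssp_reachable D s t c k X"
  shows "kssp_inv D k X"
  using assms(4) unfolding kssp_reachable_def
  by (induction rule: rtranclp_induct) (use assms(1-3) in \<open>auto intro: kssp_inv_init kssp_step_inv\<close>)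

section \<open>Counting the words of a configuration\<close>

lemma (in fin_digraph) phase_words_le:
  assumes "phase_inv G k X P"
  defines "n \<equiv> card (verts G)"
  shows "phase_words G P \<le> 6 * n\<^sup>2 + 15 * n + 4 * card (arcs G) + 12"
proof (cases P)
  case (Search j I S js)
  then show ?thesis
    using assms bda_words_le[of I S] by simp
next
  case (Insert j q)
  then have "tail_simple G q" using assms by (cases j) auto
  then show ?thesis using Insert length_tail_simple by (fastforce simp: n_def)
qed simp

lemma (in fin_digraph) kssp_words_le:
  assumes "kssp_inv G k X"
  defines "n \<equiv> card (verts G)"
  shows "kssp_words G X \<le> 4 * (k * n) + 6 * n\<^sup>2 + 16 * n + 7 * k + 7 * card (arcs G) + 17"
proof -
  have found: "length (found X) \<le> k" using assms by (simp add: kssp_inv_def)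
  have "length (tree X) \<le> Suc (n * length (found X))"
    using assms by (simp add: kssp_inv_def found_inv_def)
  also have "n * length (found X) \<le> k * n"
    using mult_right_mono[OF found, of n] by (simp add: mult.commute)
  finally have tree: "length (tree X) \<le> Suc (k * n)" by simp
  \<comment> \<open>Two words per found path, plus at most \<open>k\<close> blocked arcs in
    total.\<close>
  have blocked: "(\<Sum>f\<leftarrow>found X. 2 + length (blocked f)) \<le> 3 * k"
    using assms(1) found unfolding sum_list_addf sum_list_triv
    by (simp add: kssp_inv_def found_inv_def sum_list_triv)
  have "length (cand_suffix x) \<le> n" if "x \<in># cands X" for x
    using assms that length_tail_simple[of "cand_suffix x"]
    by (auto simp: kssp_inv_def tail_simple_append)
  then have "(\<Sum>x\<in>#cands X. 2 + length (cand_suffix x)) \<le> (\<Sum>x\<in>#cands X. 2 + n)"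
    by (intro sum_mset_mono) simp
  also have "\<dots> = size (cands X) * (2 + n)" by simp
  \<comment> \<open>The potential bound limits the queue to \<open>2 * k\<close> candidates.\<close>
  also have "\<dots> \<le> (2 * k) * (2 + n)"
    using assms found by (intro mult_right_mono) (auto simp: kssp_inv_def)
  also have "\<dots> = 4 * k + 2 * (k * n)" by (simp add: algebra_simps)
  finally have cands: "(\<Sum>x\<in>#cands X. 2 + length (cand_suffix x)) \<le> 4 * k + 2 * (k * n)" .
  have "phase_words G (phase X) \<le> 6 * n\<^sup>2 + 15 * n + 4 * card (arcs G) + 12"
    unfolding n_def using assms by (intro phase_words_le[of k X]) (simp add: kssp_inv_def)
  then show ?thesis
    using tree blocked cands unfolding kssp_words_def n_def[symmetric] by linarith
qed

theorem theorem8: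
  shows "\<exists>C::nat. \<forall>(D :: ('v, 'a) pre_digraph) (s :: 'v) (t :: 'v) (c :: 'a \<Rightarrow> real) (k :: nat).
    fin_digraph D \<longrightarrow> s \<in> verts D \<longrightarrow> t \<in> verts D \<longrightarrow> (\<forall>a\<in>arcs D. 0 \<le> c a) \<longrightarrow>
    2 \<le> k \<longrightarrow> k \<le> card {p. pre_digraph.apath D s p t} \<longrightarrow>
    (\<forall>X. kssp_reachable D s t c k X \<longrightarrow>
      kssp_words D X \<le> C * (k * card (verts D) + (card (verts D))\<^sup>2 + card (arcs D)))"
proof (intro exI[of _ 50] allI impI)
  fix D :: "('v, 'a) pre_digraph" and s t :: 'v and c :: "'a \<Rightarrow> real" and k :: nat and X
  assume D: "fin_digraph D" and s: "s \<in> verts D" and k: "2 \<le> k"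
    and X: "kssp_reachable D s t c k X"
  interpret fin_digraph D by fact
  define n where "n = card (verts D)"
  \<comment> \<open>With \<open>n\<close> positive, \<open>k\<close> is absorbed by
    \<open>k * n\<close>, and \<open>n\<close> and constants by \<open>n\<^sup>2\<close>. The
    coefficients become \<open>4 + 7 = 11\<close>, \<open>6 + 16 + 17 = 39\<close> and
    \<open>7\<close>, all below \<open>50\<close>.\<close>
  have "1 \<le> n" using s by (auto simp: n_def Suc_le_eq card_gt_0_iff)
  then have "k \<le> k * n" "n \<le> n\<^sup>2" "1 \<le> n\<^sup>2"
    by (simp_all add: power2_eq_square)
  moreover have "kssp_words D X \<le> 4 * (k * n) + 6 * n\<^sup>2 + 16 * n + 7 * k + 7 * card (arcs D) + 17"
    unfolding n_def using kssp_reachable_inv[OF D s _ X] k by (intro kssp_words_le) simp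
  ultimately show "kssp_words D X \<le> 50 * (k * card (verts D) + (card (verts D))\<^sup>2 + card (arcs D))"
    unfolding n_def[symmetric] distrib_left by linarith
qed

end
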